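(* Let $\bar H(w)$ and $\bar F(w)$ be the block matrices defined in the context. Then a linear parameter-varying fault detection filter of the form $r=a^{-1}(\mathfrak q)N(w,\mathfrak q)L(w_k,\mathfrak q)[z]$ can be found at every time instance $k$, depending on $w_k$, that fulfills $$a^{-1}(\mathfrak q)N(w,\mathfrak q)H(w_k,\mathfrak q)=0\quad\forall w_k\in\mathcal W,\qquad a^{-1}(\mathfrak q)N(w,\mathfrak q)F(w_k,\mathfrak q)\neq 0\quad\forall w_k\in\mathcal W,$$ by solving the following convex quadratic program: $$\bar N^*(w)=\arg\min_{\bar N}\; -\lVert\bar N\bar F(w)\rVert_\infty+\lVert\bar N^{\intercal}\rVert_2^2\qquad\text{s.t.}\quad \bar N\bar H(w)=0,$$ where $\lVert\cdot\rVert_\infty$ denotes the supremum norm.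
   Context: $\mathfrak q$ is the shift operator on discrete-time signals, $\mathfrak q[x(k)]=x(k+1)$. The system considered is $H(w_k,\mathfrak q)[x]+L(w_k,\mathfrak q)[z]+F(w_k,\mathfrak q)[f]=0$, where $x$ (state and disturbances) and $f$ (fault) are unknown signals and $z$ is a known signal; $H(w_k,\mathfrak q)=\sum_{i=0}^{d_H}H_i(w_k)\mathfrak q^i$, $F(w_k,\mathfrak q)=\sum_{i=0}^{d_F}F_i(w_k)\mathfrak q^i$ and $L(w_k,\mathfrak q)$ are polynomials in $\mathfrak q$ whose matrix coefficients have $n_r$ rows and $n_x,n_f,n_z$ columns respectively. The parameter signal $w$ is measurable in real time and takes values in a compact set $\mathcal W\subseteq\mathbb R^{n_w}$. $a(\mathfrak q)=\sum_{i=0}^{d_a}a_i\mathfrak q^i$ is a stable scalar polynomial whose degree is not less than that of $N(w,\mathfrak q)L(w_k,\mathfrak q)$. The filter numerator is $N(w,\mathfrak q)=\sum_{i=0}^{d_N}N_i(w)\mathfrak q^i$, with coefficients collected in the row $\bar N(w)=\begin{bmatrix}N_0(w)&N_1(w)&\cdots&N_{d_N}(w)\end{bmatrix}$; the solution $\bar N^*(w)$ of the program supplies these coefficients. $\bar H(w)$ and $\bar F(w)$ (at time $k$) have block rows $i=0,\dots,d_N$ and block columns $l=0,\dots,d_N+d_H$ (resp. $l=0,\dots,d_N+d_F$), with $(i,l)$ block $H_{l-i}(w_{k-d_a+i})$ if $0\le l-i\le d_H$ and $0$ otherwise (resp. $F_{l-i}(w_{k-d_a+i})$ if $0\le l-i\le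 d_F$ and $0$ otherwise). Writing $w$ without time index indicates dependence on $w_{k-d_a},\dots,w_k$.
   Formalization: The condition a^{-1}NF≠0 is claimed only where some filter of this form with the same d_N meets both conditions (if H is the identity, only N=0 is feasible); the cost, not convex in general, is shown to be a minimum of finitely many convex quadratic costs. *)

theory Defs
  imports "HOL-Analysis.Analysis"
begin

section \<open>Signals and polynomial operators in the shift\<close>

definition shift :: "(int \<Rightarrow> 'a) \<Rightarrow> int \<Rightarrow> 'a"
  where "shift x = (\<lambda>k. x (k + 1))"

text \<open>Signals with zero initial conditions: they vanish before some start time. On these the
  causal inverse of a scalar polynomial in the shift is defined without a growth condition.\<close>

definition rest_signals :: "(int \<Rightarrow> 'a::zero) set"
  where "rest_signals = {x. \<exists>k0. \<forall>k<k0. x k = 0}"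

definition scalar_op :: "real poly \<Rightarrow> (int \<Rightarrow> real) \<Rightarrow> int \<Rightarrow> real"
  where "scalar_op a r = (\<lambda>m. \<Sum>i\<le>degree a. coeff a i * (shift ^^ i) r m)"

definition stable_poly :: "real poly \<Rightarrow> bool"
  where "stable_poly a \<longleftrightarrow> (\<forall>s::complex. poly (map_poly of_real a) s = 0 \<longrightarrow> norm s < 1)"

definition scalar_op_inv :: "real poly \<Rightarrow> (int \<Rightarrow> real) \<Rightarrow> int \<Rightarrow> real"
  where "scalar_op_inv a = inv_into rest_signals (scalar_op a)"

lemma shift_pow: "(shift ^^ i) x m = x (m + int i)"
  by (induction i arbitrary: m) (simp_all add: shift_def algebra_simps)

text \<open>\<open>scalar_op_inv a\<close> is a two-sided inverse on signals with zero initial conditions.\<close>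

lemma bij_betw_scalar_op:
  assumes "a \<noteq> 0"
  shows "bij_betw (scalar_op a) rest_signals rest_signals"
proof -
  define d where "d = degree a"
  define c where "c = coeff a d"
  have c0: "c \<noteq> 0" using assms by (simp add: c_def d_def)
  have op: "scalar_op a r m = (\<Sum>i<d. coeff a i * r (m + int i)) + c * r (m + int d)" for r m
    unfolding scalar_op_def d_def[symmetric] c_def lessThan_Suc_atMost[symmetric]
    by (simp add: shift_pow)
  have inj: "r = s" if r: "r \<in> rest_signals" and s: "s \<in> rest_signals"
    and eq: "scalar_op a r = scalar_op a s" for r s
  proof -
    obtain k1 k2 where k: "\<forall>k<k1. r k = 0" "\<forall>k<k2. s k = 0"
      using r s by (auto simp: rest_signals_def)
    define k0 where "k0 = min k1 k2"
    have "\<forall>n. n < N \<longrightarrow> r (k0 + int n) = s (k0 + int n)" for N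
    proof (induction N)
      case (Suc N)
      have low: "r (k0 + int N - int d + int i) = s (k0 + int N - int d + int i)" if "i < d" for i
      proof (cases "k0 + int N - int d + int i < k0")
        case True
        then show ?thesis using k by (simp add: k0_def)
      next
        case False
        then have "k0 + int N - int d + int i = k0 + int (N + i - d)" "N + i - d < N"
          using that by auto
        then show ?thesis using Suc by metis
      qed
      have "scalar_op a r (k0 + int N - int d) = scalar_op a s (k0 + int N - int d)"
        using eq by simp
      then have "r (k0 + int N) = s (k0 + int N)"
        using c0 low by (simp add: op)
      then show ?case using Suc less_Suc_eq by auto
    qed simp
    then have ge: "r (k0 + int n) = s (k0 + int n)" for n by blast
    show "r = s"
    proof
      fix j show "r j = s j"
      proof (cases "j < k0")
        case True then show ?thesis using k by (simp add: k0_def)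
      next
        case False then show ?thesis using ge[of "nat (j - k0)"] by simp
      qed
    qed
  qed
  have into: "scalar_op a r \<in> rest_signals" if "r \<in> rest_signals" for r
  proof -
    obtain k0 where "\<forall>k<k0. r k = 0" using \<open>r \<in> rest_signals\<close> by (auto simp: rest_signals_def)
    then have "\<forall>k<k0 - int d. scalar_op a r k = 0"
      by (auto simp: op intro!: sum.neutral)
    then show ?thesis by (auto simp: rest_signals_def)
  qed
  have onto: "\<exists>r\<in>rest_signals. scalar_op a r = y" if "y \<in> rest_signals" for y
  proof -
    obtain k0 where k0: "\<forall>k<k0. y k = 0" using \<open>y \<in> rest_signals\<close> by (auto simp: rest_signals_def)
    define G where "G = (\<lambda>(g::nat \<Rightarrow> real) n. (y (k0 + int n)
      - (\<Sum>i<d. coeff a i * (if n + i < d then 0 else g (n + i - d)))) / c)"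
    define R where "R = wfrec less_than (\<lambda>g n. G g n)"
    have "adm_wf less_than G"
      unfolding adm_wf_def G_def by (auto intro!: sum.cong)
    then have R: "R n = G R n" for n
      unfolding R_def by (subst wfrec_fixpoint) auto
    define r where "r = (\<lambda>j. if j < k0 + int d then 0 else R (nat (j - k0 - int d)))"
    have "scalar_op a r m = y m" for m
    proof (cases "m < k0")
      case True
      then show ?thesis using k0 by (auto simp: op r_def intro!: sum.neutral)
    next
      case False
      define n where "n = nat (m - k0)"
      have m: "m = k0 + int n" using False by (simp add: n_def)
      have "r (m + int d) = G R n" using R by (simp add: r_def m)
      moreover have "r (m + int i) = (if n + i < d then 0 else R (n + i - d))" for i
      proof -
        have "nat (int n + int i - int d) = n + i - d" by linarith
        then show ?thesis by (auto simp: r_def m)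
      qed
      ultimately show ?thesis using c0 by (simp add: op G_def m)
    qed
    moreover have "r \<in> rest_signals" by (auto simp: rest_signals_def r_def)
    ultimately show ?thesis by blast
  qed
  show ?thesis
    unfolding bij_betw_def inj_on_def using inj into onto by (auto simp: image_iff) metis+
qed

lemma stable_poly_nonzero: "stable_poly a \<Longrightarrow> a \<noteq> 0"
  unfolding stable_poly_def by (auto dest: spec[of _ 1])

definition lpv_op ::
  "nat \<Rightarrow> (nat \<Rightarrow> 'p \<Rightarrow> real^'c^'r) \<Rightarrow> (int \<Rightarrow> 'p) \<Rightarrow> (int \<Rightarrow> real^'c) \<Rightarrow> int \<Rightarrow> real^'r"
  where "lpv_op d C w x = (\<lambda>m. \<Sum>i\<le>d. C i (w m) *v (shift ^^ i) x m)"

text \<open>The list \<open>[w (k - da), \<dots>, w k]\<close>; entry \<open>i\<close> is \<open>w (k - da + i)\<close>.\<close>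

definition window :: "nat \<Rightarrow> (int \<Rightarrow> 'p) \<Rightarrow> int \<Rightarrow> 'p list"
  where "window da w k = map (\<lambda>i. w (k - int da + int i)) [0..<Suc da]"

definition windows :: "nat \<Rightarrow> 'p set \<Rightarrow> 'p list set"
  where "windows da W = {v. length v = Suc da \<and> set v \<subseteq> W}"

text \<open>The filter numerator. Its coefficients at time \<open>k\<close> depend on the window that ends at \<open>k\<close>.
  They form the row equation of \<open>a(q)[r] = N(w,q)[y]\<close> at time \<open>m = k - da\<close>, where
  \<open>da = degree a\<close>: this is the equation that determines \<open>r k\<close> from the past.\<close>

definition numerator_op ::
  "nat \<Rightarrow> nat \<Rightarrow> ('p list \<Rightarrow> nat \<Rightarrow> real^'r) \<Rightarrow> (int \<Rightarrow> 'p) \<Rightarrow> (int \<Rightarrow> real^'r) \<Rightarrow> int \<Rightarrow> real"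
  where "numerator_op da dN N w y =
    (\<lambda>m. \<Sum>i\<le>dN. N (window da w (m + int da)) i \<bullet> (shift ^^ i) y m)"

text \<open>\<open>filter_op a dN N d C w\<close> is \<open>a\<^sup>-\<^sup>1(q) N(w,q) C(w\<^sub>k,q)\<close> for \<open>C = H, F, L\<close>, along the parameter
  trajectory \<open>w\<close>. The products are compositions of operators, so \<open>q\<close> also shifts \<open>w\<close>.\<close>

definition filter_op ::
  "real poly \<Rightarrow> nat \<Rightarrow> ('p list \<Rightarrow> nat \<Rightarrow> real^'r) \<Rightarrow> nat \<Rightarrow> (nat \<Rightarrow> 'p \<Rightarrow> real^'c^'r)
    \<Rightarrow> (int \<Rightarrow> 'p) \<Rightarrow> (int \<Rightarrow> real^'c) \<Rightarrow> int \<Rightarrow> real"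
  where "filter_op a dN N d C w x =
    scalar_op_inv a (numerator_op (degree a) dN N w (lpv_op d C w x))"

section \<open>Fault detection conditions\<close>

definition decoupled ::
  "real poly \<Rightarrow> nat \<Rightarrow> ('p list \<Rightarrow> nat \<Rightarrow> real^'r) \<Rightarrow> nat \<Rightarrow> (nat \<Rightarrow> 'p \<Rightarrow> real^'x^'r)
    \<Rightarrow> (int \<Rightarrow> 'p) \<Rightarrow> bool"
  where "decoupled a dN N dH H w \<longleftrightarrow> (\<forall>x\<in>rest_signals. filter_op a dN N dH H w x = (\<lambda>_. 0))"

definition fault_sensitive ::
  "real poly \<Rightarrow> nat \<Rightarrow> ('p list \<Rightarrow> nat \<Rightarrow> real^'r) \<Rightarrow> nat \<Rightarrow> (nat \<Rightarrow> 'p \<Rightarrow> real^'f^'r)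
    \<Rightarrow> (int \<Rightarrow> 'p) \<Rightarrow> bool"
  where "fault_sensitive a dN N dF F w \<longleftrightarrow>
    (\<exists>f\<in>rest_signals. filter_op a dN N dF F w f \<noteq> (\<lambda>_. 0))"

text \<open>The localisation of \<open>fault_sensitive\<close> to the time instance \<open>k\<close>: for some fault \<open>f\<close>, the
  response \<open>r\<close> of \<open>a\<^sup>-\<^sup>1(q) N(w,q) F(w\<^sub>k,q)\<close> has a non-zero value of
  \<open>\<Sum>i\<le>da. a\<^sub>i r(k - da + i)\<close>, the part of the recursion for \<open>r k\<close> that the coefficients
  chosen at time \<open>k\<close> contribute. In particular \<open>r\<close> is not zero on all of \<open>k - da, \<dots>, k\<close>.\<close>

definition fault_sensitive_at ::
  "real poly \<Rightarrow> nat \<Rightarrow> ('p list \<Rightarrow> nat \<Rightarrow> real^'r) \<Rightarrow> nat \<Rightarrow> (nat \<Rightarrow> 'p \<Rightarrow> real^'f^'r)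
    \<Rightarrow> (int \<Rightarrow> 'p) \<Rightarrow> int \<Rightarrow> bool"
  where "fault_sensitive_at a dN N dF F w k \<longleftrightarrow>
    (\<exists>f\<in>rest_signals. scalar_op a (filter_op a dN N dF F w f) (k - int (degree a)) \<noteq> 0)"

section \<open>The optimization program\<close>

text \<open>Block \<open>(i, l)\<close> of the matrices \<open>H\<close>-bar and \<open>F\<close>-bar, for the window \<open>v\<close>.\<close>

definition block_mat ::
  "nat \<Rightarrow> (nat \<Rightarrow> 'p \<Rightarrow> real^'c^'r) \<Rightarrow> 'p list \<Rightarrow> nat \<Rightarrow> nat \<Rightarrow> real^'c^'r"
  where "block_mat d C v i l = (if i \<le> l \<and> l - i \<le> d then C (l - i) (v ! i) else 0)"

text \<open>Block rows with blocks \<open>0, \<dots>, dN\<close> are functions on \<open>nat\<close> that vanish beyond \<open>dN\<close>, which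
  makes the representation unique.\<close>

definition block_rows :: "nat \<Rightarrow> (nat \<Rightarrow> real^'r) set"
  where "block_rows dN = {n. \<forall>i>dN. n i = 0}"

definition row_mult ::
  "nat \<Rightarrow> (nat \<Rightarrow> real^'r) \<Rightarrow> (nat \<Rightarrow> nat \<Rightarrow> real^'c^'r) \<Rightarrow> nat \<Rightarrow> real^'c"
  where "row_mult dN n B l = (\<Sum>i\<le>dN. n i v* B i l)"

definition row_sup_norm :: "nat \<Rightarrow> (nat \<Rightarrow> real^'c) \<Rightarrow> real"
  where "row_sup_norm D y = Max ((\<lambda>(l, c). \<bar>y l $ c\<bar>) ` ({..D} \<times> UNIV))"

definition row_sq_norm :: "nat \<Rightarrow> (nat \<Rightarrow> real^'r) \<Rightarrow> real"
  where "row_sq_norm dN n = (\<Sum>i\<le>dN. (norm (n i))\<^sup>2)"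

definition fd_feasible ::
  "nat \<Rightarrow> nat \<Rightarrow> (nat \<Rightarrow> 'p \<Rightarrow> real^'x^'r) \<Rightarrow> 'p list \<Rightarrow> (nat \<Rightarrow> real^'r) set"
  where "fd_feasible dN dH H v =
    {n \<in> block_rows dN. \<forall>l\<le>dN + dH. row_mult dN n (block_mat dH H v) l = 0}"

definition fd_cost ::
  "nat \<Rightarrow> nat \<Rightarrow> (nat \<Rightarrow> 'p \<Rightarrow> real^'f^'r) \<Rightarrow> 'p list \<Rightarrow> (nat \<Rightarrow> real^'r) \<Rightarrow> real"
  where "fd_cost dN dF F v n =
    - row_sup_norm (dN + dF) (row_mult dN n (block_mat dF F v)) + row_sq_norm dN n"

definition fd_solution ::
  "nat \<Rightarrow> nat \<Rightarrow> (nat \<Rightarrow> 'p \<Rightarrow> real^'x^'r) \<Rightarrow> nat \<Rightarrow> (nat \<Rightarrow> 'p \<Rightarrow> real^'f^'r) \<Rightarrow> 'p list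
    \<Rightarrow> (nat \<Rightarrow> real^'r) \<Rightarrow> bool"
  where "fd_solution dN dH H dF F v n \<longleftrightarrow>
    is_arg_min (fd_cost dN dF F v) (\<lambda>n. n \<in> fd_feasible dN dH H v) n"

text \<open>The term \<open>- \<parallel>\<cdot>\<parallel>\<^sub>\<infinity>\<close> is concave. The program is a convex quadratic one in the sense that the
  cost is the minimum of the following quadratic functions, one for each sign \<open>s \<in> {-1, 1}\<close> and
  each entry \<open>(l, c)\<close> of \<open>N F\<close> (with the bars), so that it splits into a finite family of convex
  quadratic programs.\<close>

definition fd_qp_cost ::
  "nat \<Rightarrow> nat \<Rightarrow> (nat \<Rightarrow> 'p \<Rightarrow> real^'f^'r) \<Rightarrow> 'p list \<Rightarrow> real \<times> nat \<times> 'f \<Rightarrow> (nat \<Rightarrow> real^'r) \<Rightarrow> real"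
  where "fd_qp_cost dN dF F v = (\<lambda>(s, l, c) n.
    - (s * (row_mult dN n (block_mat dF F v) l $ c)) + row_sq_norm dN n)"

definition fd_qp_index :: "nat \<Rightarrow> nat \<Rightarrow> (real \<times> nat \<times> 'f) set"
  where "fd_qp_index dN dF = {-1, 1} \<times> {..dN + dF} \<times> UNIV"

definition convex_program :: "(nat \<Rightarrow> real^'r) set \<Rightarrow> ((nat \<Rightarrow> real^'r) \<Rightarrow> real) \<Rightarrow> bool"
  where "convex_program S g \<longleftrightarrow> (\<forall>n\<in>S. \<forall>m\<in>S. \<forall>t\<in>{0..1}.
    (\<lambda>i. (1 - t) *\<^sub>R n i + t *\<^sub>R m i) \<in> S \<and>
    g (\<lambda>i. (1 - t) *\<^sub>R n i + t *\<^sub>R m i) \<le> (1 - t) * g n + t * g m)"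

end

theory Submission
  imports Defs
begin

text \<open>
  Two observations carry the proof.

  Composing the numerator with \<open>C(w\<^sub>k,q)\<close>, for \<open>C = H\<close> or \<open>C = F\<close>, gives an operator whose
  value at a time \<open>m\<close> is the inner product of the block row \<open>N C\<close> (with the bars), taken at the
  window starting at \<open>m\<close>, with the samples \<open>x m, x (m + 1), \<dots>\<close> of the input
  (\<open>numerator_op_lpv_op\<close>). Impulses recover each block of this row, and \<open>a\<^sup>-\<^sup>1(q)\<close> is injective on
  signals with zero initial conditions. So decoupling means exactly that \<open>N H\<close> vanishes at every
  window, and sensitivity at time \<open>k\<close> means exactly that \<open>N F\<close> does not vanish at the window ending
  at \<open>k\<close> (\<open>decoupled_iff\<close>, \<open>fault_sensitive_at_iff\<close>). Both
  conditions concern each window separately, so the filter can be designed one window at a time,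
  and the constraint of the program is decoupling itself.

  For a fixed window, every cost \<open>fd_qp_cost\<close> is, up to a constant, the squared distance to a fixed
  block row. It therefore attains its minimum on the feasible set, which is a closed subspace, and
  the pointwise minimum of finitely many such costs does so too (\<open>fd_solution_exists\<close>). A solution
  detects faults whenever some feasible row does (\<open>fd_solution_sensitive\<close>): the term
  \<open>- \<parallel>N F\<parallel>\<^sub>\<infinity>\<close> is of first order and \<open>\<parallel>N\<parallel>\<^sup>2\<close> of second order, so a suitably small multiple of that
  feasible row has negative cost, whereas a row with \<open>N F = 0\<close> has cost at least \<open>0\<close>.
\<close>

section \<open>Inverting a scalar polynomial in the shift\<close>

lemma scalar_op_inv_in_rest_signals:
  assumes "a \<noteq> 0" and "y \<in> rest_signals"
  shows "scalar_op_inv a y \<in> rest_signals"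
  using bij_betw_scalar_op[OF assms(1)] assms(2)
  by (simp add: scalar_op_inv_def bij_betw_def inv_into_into)

lemma scalar_op_scalar_op_inv:
  assumes "a \<noteq> 0" and "y \<in> rest_signals"
  shows "scalar_op a (scalar_op_inv a y) = y"
  using bij_betw_scalar_op[OF assms(1)] assms(2)
  by (simp add: scalar_op_inv_def bij_betw_def f_inv_into_f)

lemma scalar_op_inv_scalar_op:
  assumes "a \<noteq> 0" and "r \<in> rest_signals"
  shows "scalar_op_inv a (scalar_op a r) = r"
  using bij_betw_scalar_op[OF assms(1)] assms(2)
  by (simp add: scalar_op_inv_def bij_betw_def inv_into_f_f)

lemma scalar_op_zero: "scalar_op a (\<lambda>_. 0) = (\<lambda>_. 0)"
  by (simp add: scalar_op_def shift_pow)

lemma scalar_op_uminus: "scalar_op a (\<lambda>k. - r k) = (\<lambda>k. - scalar_op a r k)"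
  by (simp add: scalar_op_def shift_pow sum_negf)

lemma rest_signals_uminus:
  fixes y :: "int \<Rightarrow> 'a::group_add"
  shows "y \<in> rest_signals \<Longrightarrow> (\<lambda>k. - y k) \<in> rest_signals"
  by (auto simp: rest_signals_def)

lemma scalar_op_inv_uminus:
  assumes "a \<noteq> 0" and "y \<in> rest_signals"
  shows "scalar_op_inv a (\<lambda>k. - y k) = (\<lambda>k. - scalar_op_inv a y k)"
proof -
  have "(\<lambda>k. - y k) = scalar_op a (\<lambda>k. - scalar_op_inv a y k)"
    by (simp add: scalar_op_uminus scalar_op_scalar_op_inv assms)
  then show ?thesis
    by (simp add: scalar_op_inv_scalar_op scalar_op_inv_in_rest_signals rest_signals_uminus assms)
qed

lemma scalar_op_inv_eq_zero_iff:
  assumes "a \<noteq> 0" and "y \<in> rest_signals"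
  shows "scalar_op_inv a y = (\<lambda>_. 0) \<longleftrightarrow> y = (\<lambda>_. 0)"
proof
  assume "scalar_op_inv a y = (\<lambda>_. 0)"
  then show "y = (\<lambda>_. 0)"
    using scalar_op_scalar_op_inv[OF assms] by (simp add: scalar_op_zero)
next
  assume "y = (\<lambda>_. 0)"
  then show "scalar_op_inv a y = (\<lambda>_. 0)"
    using scalar_op_inv_scalar_op[OF assms(1), of "\<lambda>_. 0"] assms(2) by (simp add: scalar_op_zero)
qed

section \<open>The filter along a trajectory and the block matrices\<close>

text \<open>Any operator whose value at \<open>m\<close> is determined by the samples at \<open>m, \<dots>, m + d\<close>, with zero
  samples giving zero, starts at most \<open>d\<close> steps before its input does. This puts every
  intermediate signal of the filter in the domain on which \<open>a(q)\<close> is invertible.\<close>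

lemma rest_signals_finite_memory:
  fixes x :: "int \<Rightarrow> 'a::zero" and g :: "int \<Rightarrow> (nat \<Rightarrow> 'a) \<Rightarrow> 'b::zero"
  assumes "x \<in> rest_signals"
    and "\<And>m s. \<forall>i\<le>d. s i = 0 \<Longrightarrow> g m s = 0"
  shows "(\<lambda>m. g m (\<lambda>i. x (m + int i))) \<in> rest_signals"
proof -
  obtain k0 where "\<forall>k<k0. x k = 0"
    using assms(1) by (auto simp: rest_signals_def)
  then have "\<forall>k<k0 - int d. g k (\<lambda>i. x (k + int i)) = 0"
    by (auto intro!: assms(2))
  then show ?thesis
    by (auto simp: rest_signals_def)
qed

lemma lpv_op_in_rest_signals: "x \<in> rest_signals \<Longrightarrow> lpv_op d C w x \<in> rest_signals"
  unfolding lpv_op_def shift_pow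
  by (rule rest_signals_finite_memory[where g = "\<lambda>m s. \<Sum>i\<le>d. C i (w m) *v s i"])
    (auto intro!: sum.neutral)

lemma numerator_op_in_rest_signals:
  "y \<in> rest_signals \<Longrightarrow> numerator_op da dN N w y \<in> rest_signals"
  unfolding numerator_op_def shift_pow
  by (rule rest_signals_finite_memory
        [where g = "\<lambda>m s. \<Sum>i\<le>dN. N (window da w (m + int da)) i \<bullet> s i"])
    (auto intro!: sum.neutral)

lemma numerator_op_uminus: "numerator_op da dN N w (\<lambda>k. - y k) = (\<lambda>k. - numerator_op da dN N w y k)"
  by (simp add: numerator_op_def shift_pow sum_negf)

lemma numerator_op_add:
  "numerator_op da dN N w (\<lambda>k. y k + z k) =
    (\<lambda>k. numerator_op da dN N w y k + numerator_op da dN N w z k)"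
  by (simp add: numerator_op_def shift_pow inner_add_right sum.distrib)

text \<open>Block row \<open>i\<close> of the matrix holds the coefficients of \<open>q\<^sup>i C(w\<^sub>k,q) = C(w\<^bsub>k+i\<^esub>,q) q\<^sup>i\<close>:
  moving \<open>q\<^sup>i\<close> to the right shifts the parameter, which is why the entry \<open>i\<close> of the window is
  used there.\<close>

lemma lpv_op_eq_block_row:
  assumes "i \<le> da" and "i \<le> dN"
  shows "lpv_op d C w x (m + int i) =
    (\<Sum>l\<le>dN + d. block_mat d C (window da w (m + int da)) i l *v x (m + int l))"
proof -
  let ?v = "window da w (m + int da)"
  have v: "?v ! i = w (m + int i)"
    using assms(1) by (simp add: window_def del: upt_Suc)
  have "(\<Sum>l\<le>dN + d. block_mat d C ?v i l *v x (m + int l)) =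
      (\<Sum>l\<in>{i..i + d}. C (l - i) (w (m + int i)) *v x (m + int l))"
    using assms(2) by (intro sum.mono_neutral_cong_right) (auto simp: block_mat_def v)
  also have "\<dots> = (\<Sum>j\<le>d. C j (w (m + int i)) *v x (m + int i + int j))"
    by (rule sum.reindex_bij_witness[where i = "\<lambda>j. j + i" and j = "\<lambda>l. l - i"]) auto
  finally show ?thesis
    by (simp add: lpv_op_def shift_pow)
qed

lemma numerator_op_lpv_op:
  assumes "dN \<le> da"
  shows "numerator_op da dN N w (lpv_op d C w x) m =
    (let v = window da w (m + int da)
     in \<Sum>l\<le>dN + d. row_mult dN (N v) (block_mat d C v) l \<bullet> x (m + int l))"
proof -
  let ?v = "window da w (m + int da)"
  have "numerator_op da dN N w (lpv_op d C w x) m =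
      (\<Sum>i\<le>dN. \<Sum>l\<le>dN + d. (N ?v i v* block_mat d C ?v i l) \<bullet> x (m + int l))"
    using assms
    by (auto simp: numerator_op_def shift_pow lpv_op_eq_block_row[where da = da and dN = dN]
        dot_lmul_matrix inner_sum_right intro!: sum.cong)
  also have "\<dots> = (\<Sum>l\<le>dN + d. row_mult dN (N ?v) (block_mat d C ?v) l \<bullet> x (m + int l))"
    by (subst sum.swap) (simp add: row_mult_def inner_sum_left)
  finally show ?thesis
    by (simp add: Let_def)
qed

text \<open>The impulse \<open>y l\<close> at time \<open>m + l\<close> isolates block \<open>l\<close> of the row and has the response
  \<open>\<parallel>y l\<parallel>\<^sup>2\<close>; it has zero initial conditions, so it is an admissible input.\<close>

lemma moving_average_nonzero_iff:
  fixes y :: "nat \<Rightarrow> 'a::real_inner"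
  shows "(\<exists>x\<in>rest_signals. (\<Sum>l\<le>D. y l \<bullet> x (m + int l)) \<noteq> 0) \<longleftrightarrow> (\<exists>l\<le>D. y l \<noteq> 0)"
proof
  assume "\<exists>x\<in>rest_signals. (\<Sum>l\<le>D. y l \<bullet> x (m + int l)) \<noteq> 0"
  then obtain x where "(\<Sum>l\<le>D. y l \<bullet> x (m + int l)) \<noteq> 0" by blast
  then obtain l where "l \<in> {..D}" "y l \<bullet> x (m + int l) \<noteq> 0"
    by (rule sum.not_neutral_contains_not_neutral)
  then show "\<exists>l\<le>D. y l \<noteq> 0" by auto
next
  assume "\<exists>l\<le>D. y l \<noteq> 0"
  then obtain l0 where l0: "l0 \<le> D" "y l0 \<noteq> 0" by blast
  define x where "x = (\<lambda>k. if k = m + int l0 then y l0 else 0)"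
  have "x \<in> rest_signals"
    by (auto simp: rest_signals_def x_def intro!: exI[of _ "m + int l0"])
  moreover have "y l \<bullet> x (m + int l) = (if l = l0 then y l0 \<bullet> y l0 else 0)" for l
    by (simp add: x_def)
  then have "(\<Sum>l\<le>D. y l \<bullet> x (m + int l)) = y l0 \<bullet> y l0"
    using l0(1) by simp
  ultimately show "\<exists>x\<in>rest_signals. (\<Sum>l\<le>D. y l \<bullet> x (m + int l)) \<noteq> 0"
    using l0(2) by (metis inner_eq_zero_iff)
qed

lemma fault_sensitive_at_iff:
  assumes "a \<noteq> 0" and "dN \<le> degree a"
  shows "fault_sensitive_at a dN N d C w k \<longleftrightarrow>
    (\<exists>l\<le>dN + d. row_mult dN (N (window (degree a) w k))
      (block_mat d C (window (degree a) w k)) l \<noteq> 0)"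
proof -
  have "scalar_op a (filter_op a dN N d C w x) = numerator_op (degree a) dN N w (lpv_op d C w x)"
    if "x \<in> rest_signals" for x
    using that assms(1)
    by (simp add: filter_op_def scalar_op_scalar_op_inv numerator_op_in_rest_signals
        lpv_op_in_rest_signals)
  then show ?thesis
    using assms(2)
    by (simp add: fault_sensitive_at_def numerator_op_lpv_op Let_def moving_average_nonzero_iff
        cong: bex_cong)
qed

lemma fault_sensitive_iff_at:
  assumes "a \<noteq> 0"
  shows "fault_sensitive a dN N d C w \<longleftrightarrow> (\<exists>k. fault_sensitive_at a dN N d C w k)"
proof -
  have "filter_op a dN N d C w x \<noteq> (\<lambda>_. 0) \<longleftrightarrow>
      (\<exists>k. scalar_op a (filter_op a dN N d C w x) (k - int (degree a)) \<noteq> 0)"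
    if "x \<in> rest_signals" for x
  proof -
    have "numerator_op (degree a) dN N w (lpv_op d C w x) \<in> rest_signals"
      using that by (intro numerator_op_in_rest_signals lpv_op_in_rest_signals)
    then have "filter_op a dN N d C w x \<noteq> (\<lambda>_. 0) \<longleftrightarrow>
        scalar_op a (filter_op a dN N d C w x) \<noteq> (\<lambda>_. 0)"
      unfolding filter_op_def
      using scalar_op_inv_eq_zero_iff[OF assms] scalar_op_scalar_op_inv[OF assms] by metis
    also have "\<dots> \<longleftrightarrow> (\<exists>j. scalar_op a (filter_op a dN N d C w x) j \<noteq> 0)"
      by (simp add: fun_eq_iff)
    also have "\<dots> \<longleftrightarrow> (\<exists>k. scalar_op a (filter_op a dN N d C w x) (k - int (degree a)) \<noteq> 0)"
      by (metis add_diff_cancel_right')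
    finally show ?thesis .
  qed
  then have "fault_sensitive a dN N d C w \<longleftrightarrow> (\<exists>x\<in>rest_signals.
      \<exists>k. scalar_op a (filter_op a dN N d C w x) (k - int (degree a)) \<noteq> 0)"
    unfolding fault_sensitive_def by (rule bex_cong[OF refl])
  also have "\<dots> \<longleftrightarrow> (\<exists>k. fault_sensitive_at a dN N d C w k)"
    unfolding fault_sensitive_at_def by blast
  finally show ?thesis .
qed

text \<open>Decoupling from \<open>x\<close> is the negation of sensitivity to \<open>x\<close>, so both are governed by the same
  block rows.\<close>

lemma decoupled_iff:
  assumes "a \<noteq> 0" and "dN \<le> degree a"
  shows "decoupled a dN N d C w \<longleftrightarrow>
    (\<forall>k. \<forall>l\<le>dN + d. row_mult dN (N (window (degree a) w k))
      (block_mat d C (window (degree a) w k)) l = 0)"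
proof -
  have "decoupled a dN N d C w \<longleftrightarrow> \<not> fault_sensitive a dN N d C w"
    by (auto simp: decoupled_def fault_sensitive_def)
  then show ?thesis
    using assms by (simp add: fault_sensitive_iff_at fault_sensitive_at_iff)
qed

text \<open>On the solutions of the system the residual computed from the known signal \<open>z\<close> is the
  response to the fault alone, since the numerator annihilates the part driven by \<open>x\<close>.\<close>

lemma residual_eq_fault_response:
  assumes "a \<noteq> 0" and "decoupled a dN N dH H w"
    and rest: "x \<in> rest_signals" "z \<in> rest_signals" "f \<in> rest_signals"
    and eq: "\<And>k. lpv_op dH H w x k + lpv_op dL L w z k + lpv_op dF F w f k = 0"
  shows "filter_op a dN N dL L w z = (\<lambda>k. - filter_op a dN N dF F w f k)"
proof -
  let ?N = "numerator_op (degree a) dN N w"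
  have numH: "?N (lpv_op dH H w x) = (\<lambda>_. 0)"
    using assms(1,2) rest(1)
    by (simp add: decoupled_def filter_op_def scalar_op_inv_eq_zero_iff
        numerator_op_in_rest_signals lpv_op_in_rest_signals)
  have "lpv_op dL L w z = (\<lambda>k. - (lpv_op dH H w x k + lpv_op dF F w f k))"
    using eq by (auto simp: fun_eq_iff algebra_simps eq_neg_iff_add_eq_0)
  then have "?N (lpv_op dL L w z) = (\<lambda>k. - ?N (lpv_op dF F w f) k)"
    by (simp only: numerator_op_uminus numerator_op_add numH) simp
  then show ?thesis
    using assms(1) rest(3)
    by (simp add: filter_op_def scalar_op_inv_uminus numerator_op_in_rest_signals
        lpv_op_in_rest_signals)
qed

section \<open>The quadratic programs at a fixed window\<close>

lemma row_mult_nth: "row_mult dN n B l $ c = (\<Sum>i\<le>dN. n i \<bullet> column c (B i l))"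
  by (simp add: row_mult_def vector_matrix_mult_def column_def inner_vec_def mult.commute)

lemma row_mult_linear:
  "row_mult dN (\<lambda>i. s *\<^sub>R n i + t *\<^sub>R m i) B l = s *\<^sub>R row_mult dN n B l + t *\<^sub>R row_mult dN m B l"
  by (simp add: vec_eq_iff row_mult_nth inner_simps sum.distrib sum_distrib_left)

lemma row_mult_scaleR_truncated:
  "row_mult dN (\<lambda>i. if i \<le> dN then t *\<^sub>R n i else 0) B l = t *\<^sub>R row_mult dN n B l"
  by (simp add: vec_eq_iff row_mult_nth sum_distrib_left)

lemma fd_feasible_linear:
  assumes "n \<in> fd_feasible dN dH H v" and "m \<in> fd_feasible dN dH H v"
  shows "(\<lambda>i. s *\<^sub>R n i + t *\<^sub>R m i) \<in> fd_feasible dN dH H v"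
  using assms by (simp add: fd_feasible_def block_rows_def row_mult_linear)

lemma zero_in_fd_feasible: "(\<lambda>_. 0) \<in> fd_feasible dN dH H v"
  by (simp add: fd_feasible_def block_rows_def row_mult_def)

text \<open>Completing the square: the Hessian of the cost is a multiple of the identity, so minimizing it
  is the same as projecting \<open>p\<close> onto the feasible set.\<close>

lemma fd_qp_cost_eq_square:
  fixes F :: "nat \<Rightarrow> 'p \<Rightarrow> real^'f^'r" and dF l :: nat and v :: "'p list" and c :: 'f and s :: real
  defines "p \<equiv> \<lambda>i. (s / 2) *\<^sub>R column c (block_mat dF F v i l)"
  shows "fd_qp_cost dN dF F v (s, l, c) n =
    (\<Sum>i\<le>dN. (norm (n i - p i))\<^sup>2) - (\<Sum>i\<le>dN. (norm (p i))\<^sup>2)"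
proof -
  have "(norm (n i - p i))\<^sup>2 - (norm (p i))\<^sup>2 =
      (norm (n i))\<^sup>2 - s * (n i \<bullet> column c (block_mat dF F v i l))" for i
  proof -
    have "(norm (n i - p i))\<^sup>2 - (norm (p i))\<^sup>2 = (norm (n i))\<^sup>2 - 2 * (n i \<bullet> p i)"
      by (simp add: power2_norm_eq_inner inner_diff inner_commute)
    then show ?thesis
      by (simp add: p_def)
  qed
  then have "(\<Sum>i\<le>dN. (norm (n i - p i))\<^sup>2) - (\<Sum>i\<le>dN. (norm (p i))\<^sup>2) =
      (\<Sum>i\<le>dN. (norm (n i))\<^sup>2 - s * (n i \<bullet> column c (block_mat dF F v i l)))"
    by (simp flip: sum_subtractf)
  then show ?thesis
    by (simp add: fd_qp_cost_def row_mult_nth row_sq_norm_def sum_subtractf sum_distrib_left)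
qed

lemma row_sq_norm_convex:
  assumes "t \<in> {0..1}"
  shows "row_sq_norm dN (\<lambda>i. (1 - t) *\<^sub>R n i + t *\<^sub>R m i)
    \<le> (1 - t) * row_sq_norm dN n + t * row_sq_norm dN m"
proof -
  have "(norm ((1 - t) *\<^sub>R x + t *\<^sub>R y))\<^sup>2 \<le> (1 - t) * (norm x)\<^sup>2 + t * (norm y)\<^sup>2" for x y :: "real^'a"
  proof -
    have "(1 - t) * (norm x)\<^sup>2 + t * (norm y)\<^sup>2 - (norm ((1 - t) *\<^sub>R x + t *\<^sub>R y))\<^sup>2
        = t * (1 - t) * (norm (x - y))\<^sup>2"
      by (simp add: power2_norm_eq_inner inner_simps inner_commute) (simp add: algebra_simps)
    moreover have "0 \<le> t * (1 - t) * (norm (x - y))\<^sup>2"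
      using assms by simp
    ultimately show ?thesis by linarith
  qed
  then show ?thesis
    unfolding row_sq_norm_def sum_distrib_left sum.distrib[symmetric] by (intro sum_mono)
qed

lemma convex_program_fd_qp: "convex_program (fd_feasible dN dH H v) (fd_qp_cost dN dF F v j)"
proof (cases j)
  case (fields s l c)
  have "fd_qp_cost dN dF F v j (\<lambda>i. (1 - t) *\<^sub>R n i + t *\<^sub>R m i)
      \<le> (1 - t) * fd_qp_cost dN dF F v j n + t * fd_qp_cost dN dF F v j m" if "t \<in> {0..1}" for t n m
    using row_sq_norm_convex[OF that, of dN n m]
    by (simp add: fields fd_qp_cost_def row_mult_linear) (simp add: algebra_simps)
  then show ?thesis
    by (simp add: convex_program_def fd_feasible_linear)
qed

lemma fd_cost_eq_Min:
  "fd_cost dN dF F v n = Min ((\<lambda>j. fd_qp_cost dN dF F v j n) ` fd_qp_index dN dF)"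
proof (rule Min_eqI[symmetric])
  let ?y = "row_mult dN n (block_mat dF F v)"
  let ?A = "(\<lambda>(l, c). \<bar>?y l $ c\<bar>) ` ({..dN + dF} \<times> UNIV)"
  show "finite ((\<lambda>j. fd_qp_cost dN dF F v j n) ` fd_qp_index dN dF)"
    by (simp add: fd_qp_index_def)
  show "fd_cost dN dF F v n \<le> q"
    if q_in: "q \<in> (\<lambda>j. fd_qp_cost dN dF F v j n) ` fd_qp_index dN dF" for q
  proof -
    obtain j where j_in: "j \<in> fd_qp_index dN dF" and q: "q = fd_qp_cost dN dF F v j n"
      using q_in by blast
    obtain s l c where j_eq: "j = (s, l, c)"
      by (cases j)
    have j: "s \<in> {-1, 1}" "l \<le> dN + dF"
      using j_in by (auto simp: j_eq fd_qp_index_def)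
    have "s * ?y l $ c \<le> \<bar>?y l $ c\<bar>"
      using j(1) by auto
    also have "\<dots> \<le> Max ?A"
      using j(2) by (intro Max_ge) auto
    finally show ?thesis
      unfolding q j_eq fd_cost_def fd_qp_cost_def row_sup_norm_def prod.case
      by (intro add_mono le_imp_neg_le order_refl)
  qed
  have "Max ?A \<in> ?A"
    by (intro Max_in) auto
  then obtain l c where l: "l \<le> dN + dF" and max: "Max ?A = \<bar>?y l $ c\<bar>"
    by (elim imageE) (auto simp only: split_paired_all prod.case mem_Times_iff fst_conv snd_conv atMost_iff)
  \<comment> \<open>\<open>sgn\<close> would not do for the sign here: it is \<open>0\<close> at \<open>0\<close>.\<close>
  define s :: real where "s = (if ?y l $ c < 0 then - 1 else 1)"
  have "fd_cost dN dF F v n = fd_qp_cost dN dF F v (s, l, c) n"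
    by (simp add: fd_cost_def fd_qp_cost_def row_sup_norm_def max s_def)
  moreover have "(s, l, c) \<in> fd_qp_index dN dF"
    using l by (simp add: fd_qp_index_def s_def)
  ultimately show "fd_cost dN dF F v n \<in> (\<lambda>j. fd_qp_cost dN dF F v j n) ` fd_qp_index dN dF"
    by blast
qed

section \<open>Existence of solutions\<close>

text \<open>Block rows lie in the function space over all of \<open>nat\<close>, with its product topology. Bounded
  closed sets of them are compact nevertheless, because the components beyond \<open>dN\<close> range over
  \<open>{0}\<close>, so that Tychonoff's theorem applies.\<close>

lemma closest_block_row:
  fixes S :: "(nat \<Rightarrow> real^'r) set"
  assumes "closed S" and S: "S \<subseteq> block_rows dN" and "S \<noteq> {}"
  obtains n where "n \<in> S"
    and "\<And>m. m \<in> S \<Longrightarrow> (\<Sum>i\<le>dN. (norm (n i - p i))\<^sup>2) \<le> (\<Sum>i\<le>dN. (norm (m i - p i))\<^sup>2)"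
proof -
  define g where "g = (\<lambda>n. \<Sum>i\<le>dN. (norm (n i - p i :: real^'r))\<^sup>2)"
  obtain n0 where n0: "n0 \<in> S" using assms(3) by blast
  define K where "K = PiE UNIV (\<lambda>i. if i \<le> dN then cball (p i) (sqrt (g n0)) else {0})"
  have "compact K"
    unfolding K_def compactin_euclidean_iff[symmetric] euclidean_product_topology[symmetric] compactin_PiE
    by simp
  have in_K: "m \<in> K" if "m \<in> S" "g m \<le> g n0" for m
  proof -
    have "norm (m i - p i) \<le> sqrt (g n0)" if "i \<le> dN" for i
    proof (rule real_le_rsqrt)
      have "(norm (m i - p i))\<^sup>2 \<le> g m"
        unfolding g_def using that by (intro member_le_sum) auto
      then show "(norm (m i - p i))\<^sup>2 \<le> g n0"
        using \<open>g m \<le> g n0\<close> by simp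
    qed
    then show ?thesis
      using that(1) S by (auto simp: K_def block_rows_def dist_norm norm_minus_commute)
  qed
  have "continuous_on (S \<inter> K) g"
    unfolding g_def
    by (intro continuous_intros continuous_on_product_then_coordinatewise continuous_on_id)
  moreover have "compact (S \<inter> K)"
    using assms(1) \<open>compact K\<close> by (rule closed_Int_compact)
  moreover have "n0 \<in> S \<inter> K"
    using n0 in_K by blast
  ultimately obtain n where n: "n \<in> S \<inter> K" "\<And>m. m \<in> S \<inter> K \<Longrightarrow> g n \<le> g m"
    using continuous_attains_inf[of "S \<inter> K" g] by blast
  have "g n \<le> g m" if "m \<in> S" for m
    using n in_K[OF that] \<open>n0 \<in> S \<inter> K\<close> that by force
  with n(1) that show ?thesis
    by (auto simp: g_def)
qed

lemma closed_fd_feasible: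
  fixes H :: "nat \<Rightarrow> 'p \<Rightarrow> real^'x^'r"
  shows "closed (fd_feasible dN dH H v)"
proof -
  have coord: "continuous_on UNIV (\<lambda>n :: nat \<Rightarrow> real^'r. n i)" for i
    by (rule continuous_on_product_coordinates)
  have support: "closed {n. n i = (0 :: real^'r)}" for i :: nat
    by (intro closed_Collect_eq coord continuous_on_const)
  have row: "closed {n. row_mult dN n (block_mat dH H v) l $ c = 0}" for l c
    unfolding row_mult_nth
    by (intro closed_Collect_eq continuous_on_sum continuous_on_inner coord continuous_on_const)
  have "fd_feasible dN dH H v = (\<Inter>i\<in>{dN<..}. {n. n i = 0}) \<inter>
      (\<Inter>l\<in>{..dN + dH}. \<Inter>c. {n. row_mult dN n (block_mat dH H v) l $ c = 0})"
    by (auto simp: fd_feasible_def block_rows_def vec_eq_iff)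
  moreover have "closed \<dots>"
    by (intro closed_Int closed_INT ballI support row)
  ultimately show ?thesis by simp
qed

text \<open>The minimum over feasible rows of a minimum over indices may be taken in the other order: among
  the minimizers of the finitely many convex programs, the best one solves the original one.\<close>

lemma fd_solution_exists:
  fixes F :: "nat \<Rightarrow> 'p \<Rightarrow> real^'f^'r"
  shows "\<exists>n. fd_solution dN dH H dF F v n"
proof -
  let ?S = "fd_feasible dN dH H v" and ?J = "fd_qp_index dN dF :: (real \<times> nat \<times> 'f) set"
  let ?q = "fd_qp_cost dN dF F v"
  have "\<exists>n\<in>?S. \<forall>m\<in>?S. ?q j n \<le> ?q j m" for j
  proof (cases j)
    case (fields s l c)
    let ?p = "\<lambda>i. (s / 2) *\<^sub>R column c (block_mat dF F v i l)"
    have "?S \<subseteq> block_rows dN" "?S \<noteq> {}"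
      using zero_in_fd_feasible by (force simp: fd_feasible_def)+
    then obtain n where "n \<in> ?S"
      and "\<And>m. m \<in> ?S \<Longrightarrow> (\<Sum>i\<le>dN. (norm (n i - ?p i))\<^sup>2) \<le> (\<Sum>i\<le>dN. (norm (m i - ?p i))\<^sup>2)"
      by (rule closest_block_row[OF closed_fd_feasible, of dN dH H v dN ?p]) blast
    then show ?thesis
      by (auto simp: fields fd_qp_cost_eq_square)
  qed
  then have "\<forall>j. \<exists>n. n \<in> ?S \<and> (\<forall>m\<in>?S. ?q j n \<le> ?q j m)"
    by blast
  from choice[OF this] obtain n where n: "\<And>j. n j \<in> ?S" "\<And>j m. m \<in> ?S \<Longrightarrow> ?q j (n j) \<le> ?q j m"
    by blast
  have J: "finite ?J" "?J \<noteq> {}"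
    by (auto simp: fd_qp_index_def)
  obtain j0 where j0: "j0 \<in> ?J" "\<And>j. j \<in> ?J \<Longrightarrow> ?q j0 (n j0) \<le> ?q j (n j)"
    using arg_min_if_finite[OF J, of "\<lambda>j. ?q j (n j)"] by (meson not_less)
  have "fd_cost dN dF F v (n j0) \<le> fd_cost dN dF F v m" if m: "m \<in> ?S" for m
  proof -
    have "fd_cost dN dF F v m \<in> (\<lambda>j. ?q j m) ` ?J"
      unfolding fd_cost_eq_Min using J by (intro Min_in) auto
    then obtain j where j: "j \<in> ?J" "fd_cost dN dF F v m = ?q j m"
      by blast
    have "fd_cost dN dF F v (n j0) \<le> ?q j0 (n j0)"
      using j0(1) J by (auto simp: fd_cost_eq_Min)
    also have "\<dots> \<le> ?q j m"
      using j0(2)[OF j(1)] n(2)[OF m, of j] by linarith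
    finally show ?thesis
      by (simp add: j)
  qed
  then show ?thesis
    using n(1)[of j0] unfolding fd_solution_def is_arg_min_linorder by blast
qed

section \<open>Solutions detect every detectable fault\<close>

lemma fd_solution_feasible:
  "fd_solution dN dH H dF F v n \<Longrightarrow> l \<le> dN + dH \<Longrightarrow> row_mult dN n (block_mat dH H v) l = 0"
  by (simp add: fd_solution_def is_arg_min_def fd_feasible_def)

text \<open>The row \<open>m\<close> stands for the coefficients of any competing decoupled filter, so it lies in the
  feasible set only after truncation at \<open>dN\<close>. A multiple of this truncation has negative cost and
  beats every row with \<open>N F = 0\<close>.\<close>

lemma fd_solution_sensitive:
  assumes sol: "fd_solution dN dH H dF F v n"
    and feas: "\<And>l. l \<le> dN + dH \<Longrightarrow> row_mult dN m (block_mat dH H v) l = 0"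
    and sens: "l \<le> dN + dF" "row_mult dN m (block_mat dF F v) l \<noteq> 0"
  shows "\<exists>l\<le>dN + dF. row_mult dN n (block_mat dF F v) l \<noteq> 0"
proof (rule ccontr)
  assume "\<not> (\<exists>l\<le>dN + dF. row_mult dN n (block_mat dF F v) l \<noteq> 0)"
  then have "row_sup_norm (dN + dF) (row_mult dN n (block_mat dF F v)) = 0"
    unfolding row_sup_norm_def by (intro Max_eqI) (auto simp: image_iff)
  then have nonneg: "0 \<le> fd_cost dN dF F v n"
    by (simp add: fd_cost_def row_sq_norm_def sum_nonneg)
  obtain c where c: "row_mult dN m (block_mat dF F v) l $ c \<noteq> 0"
    using sens(2) by (auto simp: vec_eq_iff)
  define y where "y = row_mult dN m (block_mat dF F v) l $ c"
  define q where "q = row_sq_norm dN m"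
  have q: "0 \<le> q"
    by (simp add: q_def row_sq_norm_def sum_nonneg)
  \<comment> \<open>The parabola \<open>- t * y + t\<^sup>2 * q\<close> is negative for every \<open>t\<close> strictly between \<open>0\<close> and
      \<open>y / q\<close>; with the denominator \<open>q + 1\<close>, its value is exactly \<open>- t\<^sup>2\<close>.\<close>
  define t where "t = y / (q + 1)"
  define m' where "m' = (\<lambda>i. if i \<le> dN then t *\<^sub>R m i else 0)"
  have "m' \<in> fd_feasible dN dH H v"
    using feas by (simp add: fd_feasible_def block_rows_def m'_def row_mult_scaleR_truncated)
  then have "fd_cost dN dF F v n \<le> fd_cost dN dF F v m'"
    using sol by (simp add: fd_solution_def is_arg_min_linorder)
  also have "\<dots> \<le> fd_qp_cost dN dF F v (1, l, c) m'"
    using sens(1) unfolding fd_cost_eq_Min by (intro Min_le) (auto simp: fd_qp_index_def)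
  also have "\<dots> = - (t * y) + t\<^sup>2 * q"
    by (simp add: fd_qp_cost_def q_def y_def row_sq_norm_def m'_def row_mult_scaleR_truncated
        power_mult_distrib sum_distrib_left)
  also have "\<dots> = - (t\<^sup>2)"
  proof -
    have "t * (q + 1) = y"
      using q by (simp add: t_def)
    then show ?thesis by (auto simp: power2_eq_square algebra_simps)
  qed
  also have "\<dots> < 0"
    using q c by (simp add: t_def y_def)
  finally show False
    using nonneg by simp
qed

lemma window_in_windows: "(\<And>k. w k \<in> W) \<Longrightarrow> window da w k \<in> windows da W"
  by (auto simp: window_def windows_def simp del: upt_Suc)

theorem proposition3p3:
  fixes W :: "(real^'w) set"
    and H :: "nat \<Rightarrow> real^'w \<Rightarrow> real^'x^'r"
    and L :: "nat \<Rightarrow> real^'w \<Rightarrow> real^'z^'r"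
    and F :: "nat \<Rightarrow> real^'w \<Rightarrow> real^'f^'r"
    and dH dL dF dN :: nat
    and a :: "real poly"
  assumes "compact W"
    and "stable_poly a"
    and "dN + dL \<le> degree a"
  shows
    "(\<forall>v \<in> windows (degree a) W.
        (\<exists>n. fd_solution dN dH H dF F v n) \<and>
        (\<forall>n. fd_cost dN dF F v n = Min ((\<lambda>j. fd_qp_cost dN dF F v j n) ` fd_qp_index dN dF)) \<and>
        (\<forall>j \<in> fd_qp_index dN dF. convex_program (fd_feasible dN dH H v) (fd_qp_cost dN dF F v j)))
     \<and>
     (\<forall>Nstar :: (real^'w) list \<Rightarrow> nat \<Rightarrow> real^'r.
        (\<forall>v \<in> windows (degree a) W. fd_solution dN dH H dF F v (Nstar v)) \<longrightarrow>
        (\<forall>w :: int \<Rightarrow> real^'w. (\<forall>k. w k \<in> W) \<longrightarrow>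
           decoupled a dN Nstar dH H w \<and>
           ((\<exists>N. decoupled a dN N dH H w \<and> fault_sensitive a dN N dF F w) \<longrightarrow>
              fault_sensitive a dN Nstar dF F w) \<and>
           (\<forall>k. (\<exists>N. decoupled a dN N dH H w \<and> fault_sensitive_at a dN N dF F w k) \<longrightarrow>
              fault_sensitive_at a dN Nstar dF F w k) \<and>
           (\<forall>x \<in> rest_signals. \<forall>z \<in> rest_signals. \<forall>f \<in> rest_signals.
              (\<forall>k. lpv_op dH H w x k + lpv_op dL L w z k + lpv_op dF F w f k = 0) \<longrightarrow>
              filter_op a dN Nstar dL L w z = (\<lambda>k. - filter_op a dN Nstar dF F w f k))))"
proof (intro conjI ballI allI impI)
  show "\<exists>n. fd_solution dN dH H dF F v n" for v
    by (rule fd_solution_exists)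
  show "fd_cost dN dF F v n = Min ((\<lambda>j. fd_qp_cost dN dF F v j n) ` fd_qp_index dN dF)" for v n
    by (rule fd_cost_eq_Min)
  show "convex_program (fd_feasible dN dH H v) (fd_qp_cost dN dF F v j)" for v j
    by (rule convex_program_fd_qp)
next
  fix Nstar :: "(real^'w) list \<Rightarrow> nat \<Rightarrow> real^'r" and w :: "int \<Rightarrow> real^'w"
  assume sol: "\<forall>v \<in> windows (degree a) W. fd_solution dN dH H dF F v (Nstar v)"
    and w: "\<forall>k. w k \<in> W"
  have a: "a \<noteq> 0"
    using assms(2) by (rule stable_poly_nonzero)
  have dN: "dN \<le> degree a"
    using assms(3) by simp
  have sol_w: "fd_solution dN dH H dF F (window (degree a) w k) (Nstar (window (degree a) w k))" for k
    using sol w by (simp add: window_in_windows)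
  show dec: "decoupled a dN Nstar dH H w"
    using fd_solution_feasible[OF sol_w] by (simp add: decoupled_iff[OF a dN])
  have sens: "fault_sensitive_at a dN Nstar dF F w k"
    if N: "decoupled a dN N dH H w" "fault_sensitive_at a dN N dF F w k" for N k
  proof -
    let ?v = "window (degree a) w k"
    have "row_mult dN (N ?v) (block_mat dH H ?v) l = 0" if "l \<le> dN + dH" for l
      using N(1) that by (simp add: decoupled_iff[OF a dN])
    moreover obtain l where "l \<le> dN + dF" "row_mult dN (N ?v) (block_mat dF F ?v) l \<noteq> 0"
      using N(2) by (auto simp: fault_sensitive_at_iff[OF a dN])
    ultimately show ?thesis
      unfolding fault_sensitive_at_iff[OF a dN] by (rule fd_solution_sensitive[OF sol_w])
  qed
  show "fault_sensitive_at a dN Nstar dF F w k"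
    if "\<exists>N. decoupled a dN N dH H w \<and> fault_sensitive_at a dN N dF F w k" for k
    using that sens by blast
  show "fault_sensitive a dN Nstar dF F w"
    if "\<exists>N. decoupled a dN N dH H w \<and> fault_sensitive a dN N dF F w"
    using that sens by (auto simp: fault_sensitive_iff_at[OF a])
  show "filter_op a dN Nstar dL L w z = (\<lambda>k. - filter_op a dN Nstar dF F w f k)"
    if "x \<in> rest_signals" "z \<in> rest_signals" "f \<in> rest_signals"
      and "\<forall>k. lpv_op dH H w x k + lpv_op dL L w z k + lpv_op dF F w f k = 0" for x z f
    using that by (intro residual_eq_fault_response[OF a dec]) auto
qed

end
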